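(* Let $n\ge 2$. 1. The Lie algebra $\mathfrak{u}_n$ is solvable but not nilpotent. 2. The finite chain of ideals $\mathfrak{u}_n=\mathfrak{u}_{n,1}\supset \mathfrak{u}_{n,2}\supset\cdots\supset\mathfrak{u}_{n,n}\supset\mathfrak{u}_{n,n+1}=0$ is the derived series of $\mathfrak{u}_n$, that is, $(\mathfrak{u}_n)_{(i)}=\mathfrak{u}_{n,i+1}$ for all $i\ge 0$. 3. The upper central series of $\mathfrak{u}_n$ stabilizes at the first step, that is, $(\mathfrak{u}_n)^{(0)}=\mathfrak{u}_n$ and $(\mathfrak{u}_n)^{(i)}=\mathfrak{u}_{n,2}$ for all $i\ge 1$. 4. Each element $u\in\mathfrak{u}_n$ acts locally nilpotently on the $\mathfrak{u}_n$-module $P_n$. 5. All inner derivations of the Lie algebra $\mathfrak{u}_n$ are locally nilpotent derivations. 6. The centre of $\mathfrak{u}_n$ is $Z(\mathfrak{u}_n)=K\partial_n$. 7. The Lie algebras $\mathfrak{u}_n$, $n\ge 2$, are pairwise non-isomorphic.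
   Context: $K$ is a field of characteristic zero, $P_0=K$, $P_i=K[x_1,\ldots,x_i]$, $\partial_i=\partial/\partial x_i$. For $n\ge 2$, $\mathfrak{u}_n=K\partial_1+P_1\partial_2+\cdots+P_{n-1}\partial_n$ is the Lie algebra of triangular polynomial derivations, a Lie subalgebra of $\mathrm{Der}_K(P_n)$; it acts on $P_n$ by derivations. For $1\le i\le n$, $\mathfrak{u}_{n,i}=\sum_{j=i}^nP_{j-1}\partial_j$, and $\mathfrak{u}_{n,i}=0$ for $i\ge n+1$. For a Lie algebra $\mathcal{G}$ and subspaces $U,V$, $[U,V]$ is the linear span of all $[u,v]$ with $u\in U$, $v\in V$. Put $\mathcal{G}_{(0)}=\mathcal{G}^{(0)}=\mathcal{G}$, and for $i\ge 1$, $\mathcal{G}_{(i)}=[\mathcal{G}_{(i-1)},\mathcal{G}_{(i-1)}]$ (the derived series) and $\mathcal{G}^{(i)}=[\mathcal{G},\mathcal{G}^{(i-1)}]$ (called here the upper central series). A $K$-linear map $\delta:V\to V$ is locally nilpotent (acts locally nilpotently on $V$) if for each $v\in V$ one has $\delta^i(v)=0$ for all sufficiently large $i$. The inner derivation associated with $a\in\mathcal{G}$ is $\mathrm{ad}(a):b\mapsto[a,b]$. *)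

theory Defs
  imports Complex_Main "HOL-Library.Poly_Mapping" "HOL-Library.Function_Algebras"
begin

section \<open>Lie algebras as subspaces of an ambient vector space\<close>

definition linear_map_on ::
  "('k \<Rightarrow> 'v::plus \<Rightarrow> 'v) \<Rightarrow> ('k \<Rightarrow> 'w::plus \<Rightarrow> 'w) \<Rightarrow> 'v set \<Rightarrow> 'w set \<Rightarrow> ('v \<Rightarrow> 'w) \<Rightarrow> bool" where
  "linear_map_on s t V W f \<longleftrightarrow>
     (\<forall>x\<in>V. f x \<in> W) \<and>
     (\<forall>x\<in>V. \<forall>y\<in>V. f (x + y) = f x + f y) \<and>
     (\<forall>c. \<forall>x\<in>V. f (s c x) = t c (f x))"

definition locally_nilpotent_on ::
  "('k \<Rightarrow> 'v::{plus,zero} \<Rightarrow> 'v) \<Rightarrow> 'v set \<Rightarrow> ('v \<Rightarrow> 'v) \<Rightarrow> bool" where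
  "locally_nilpotent_on s V \<delta> \<longleftrightarrow>
     linear_map_on s s V V \<delta> \<and> (\<forall>v\<in>V. \<exists>N. \<forall>i\<ge>N. (\<delta> ^^ i) v = 0)"

text \<open>Only the carrier \<open>G\<close> is required to be a Lie algebra; the bracket may behave arbitrarily
  on the rest of the ambient type.\<close>

locale lie_algebra = vector_space scale
  for scale :: "'k::field \<Rightarrow> 'g::ab_group_add \<Rightarrow> 'g" +
  fixes br :: "'g \<Rightarrow> 'g \<Rightarrow> 'g" and G :: "'g set"
  assumes subspace_carrier: "subspace G"
    and br_closed: "x \<in> G \<Longrightarrow> y \<in> G \<Longrightarrow> br x y \<in> G"
    and br_add_left: "x \<in> G \<Longrightarrow> y \<in> G \<Longrightarrow> z \<in> G \<Longrightarrow> br (x + y) z = br x z + br y z"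
    and br_add_right: "x \<in> G \<Longrightarrow> y \<in> G \<Longrightarrow> z \<in> G \<Longrightarrow> br x (y + z) = br x y + br x z"
    and br_scale_left: "x \<in> G \<Longrightarrow> y \<in> G \<Longrightarrow> br (scale c x) y = scale c (br x y)"
    and br_scale_right: "x \<in> G \<Longrightarrow> y \<in> G \<Longrightarrow> br x (scale c y) = scale c (br x y)"
    and br_self: "x \<in> G \<Longrightarrow> br x x = 0"
    and jacobi: "x \<in> G \<Longrightarrow> y \<in> G \<Longrightarrow> z \<in> G \<Longrightarrow>
       br x (br y z) + br y (br z x) + br z (br x y) = 0"

definition bracket_span ::
  "('k::field \<Rightarrow> 'g::ab_group_add \<Rightarrow> 'g) \<Rightarrow> ('g \<Rightarrow> 'g \<Rightarrow> 'g) \<Rightarrow> 'g set \<Rightarrow> 'g set \<Rightarrow> 'g set" where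
  "bracket_span scale br U V = module.span scale {br u v | u v. u \<in> U \<and> v \<in> V}"

primrec derived_series ::
  "('k::field \<Rightarrow> 'g::ab_group_add \<Rightarrow> 'g) \<Rightarrow> ('g \<Rightarrow> 'g \<Rightarrow> 'g) \<Rightarrow> 'g set \<Rightarrow> nat \<Rightarrow> 'g set" where
  "derived_series scale br G 0 = G"
| "derived_series scale br G (Suc i) =
     bracket_span scale br (derived_series scale br G i) (derived_series scale br G i)"

text \<open>The series \<open>G \<supseteq> [G,G] \<supseteq> [G,[G,G]] \<supseteq> \<dots>\<close> is called here the upper central series;
  elsewhere this is usually the lower central series.\<close>

primrec upper_central_series ::
  "('k::field \<Rightarrow> 'g::ab_group_add \<Rightarrow> 'g) \<Rightarrow> ('g \<Rightarrow> 'g \<Rightarrow> 'g) \<Rightarrow> 'g set \<Rightarrow> nat \<Rightarrow> 'g set" where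
  "upper_central_series scale br G 0 = G"
| "upper_central_series scale br G (Suc i) =
     bracket_span scale br G (upper_central_series scale br G i)"

definition lie_solvable ::
  "('k::field \<Rightarrow> 'g::ab_group_add \<Rightarrow> 'g) \<Rightarrow> ('g \<Rightarrow> 'g \<Rightarrow> 'g) \<Rightarrow> 'g set \<Rightarrow> bool" where
  "lie_solvable scale br G \<longleftrightarrow> (\<exists>i. derived_series scale br G i = {0})"

definition lie_nilpotent ::
  "('k::field \<Rightarrow> 'g::ab_group_add \<Rightarrow> 'g) \<Rightarrow> ('g \<Rightarrow> 'g \<Rightarrow> 'g) \<Rightarrow> 'g set \<Rightarrow> bool" where
  "lie_nilpotent scale br G \<longleftrightarrow> (\<exists>i. upper_central_series scale br G i = {0})"

definition lie_ideal ::
  "('k::field \<Rightarrow> 'g::ab_group_add \<Rightarrow> 'g) \<Rightarrow> ('g \<Rightarrow> 'g \<Rightarrow> 'g) \<Rightarrow> 'g set \<Rightarrow> 'g set \<Rightarrow> bool" where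
  "lie_ideal scale br G I \<longleftrightarrow>
     module.subspace scale I \<and> I \<subseteq> G \<and> (\<forall>x\<in>G. \<forall>y\<in>I. br x y \<in> I)"

definition lie_centre :: "('g \<Rightarrow> 'g \<Rightarrow> 'g::zero) \<Rightarrow> 'g set \<Rightarrow> 'g set" where
  "lie_centre br G = {z \<in> G. \<forall>x\<in>G. br z x = 0}"

definition lie_derivation ::
  "('k::field \<Rightarrow> 'g::ab_group_add \<Rightarrow> 'g) \<Rightarrow> ('g \<Rightarrow> 'g \<Rightarrow> 'g) \<Rightarrow> 'g set \<Rightarrow> ('g \<Rightarrow> 'g) \<Rightarrow> bool" where
  "lie_derivation scale br G \<delta> \<longleftrightarrow>
     linear_map_on scale scale G G \<delta> \<and>
     (\<forall>x\<in>G. \<forall>y\<in>G. \<delta> (br x y) = br (\<delta> x) y + br x (\<delta> y))"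

definition lie_isomorphic ::
  "('k::field \<Rightarrow> 'g::ab_group_add \<Rightarrow> 'g) \<Rightarrow> ('g \<Rightarrow> 'g \<Rightarrow> 'g) \<Rightarrow> 'g set \<Rightarrow>
   ('k \<Rightarrow> 'h::ab_group_add \<Rightarrow> 'h) \<Rightarrow> ('h \<Rightarrow> 'h \<Rightarrow> 'h) \<Rightarrow> 'h set \<Rightarrow> bool" where
  "lie_isomorphic s b G t c H \<longleftrightarrow>
     (\<exists>\<phi>. linear_map_on s t G H \<phi> \<and> bij_betw \<phi> G H \<and>
       (\<forall>x\<in>G. \<forall>y\<in>G. \<phi> (b x y) = c (\<phi> x) (\<phi> y)))"


section \<open>Polynomials and their derivations\<close>

text \<open>An element of the following type is a polynomial in countably many variables \<open>x\<^sub>i\<close>, \<open>i :: nat\<close>: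
  a finitely supported map from monomials (finitely supported exponent vectors) to coefficients.\<close>

type_synonym 'a mpoly = "(nat \<Rightarrow>\<^sub>0 nat) \<Rightarrow>\<^sub>0 'a"
type_synonym 'a mpoly_map = "'a mpoly \<Rightarrow> 'a mpoly"

definition Pol :: "nat \<Rightarrow> 'a::field_char_0 mpoly set" where
  "Pol i = {p. \<forall>m\<in>Poly_Mapping.keys p. Poly_Mapping.keys m \<subseteq> {1..i}}"

definition pscale :: "'a::field_char_0 \<Rightarrow> 'a mpoly \<Rightarrow> 'a mpoly" where
  "pscale c p = Poly_Mapping.single 0 c * p"

text \<open>In the summand of \<open>pdiff\<close> the exponent subtraction is truncated, but the coefficient vanishes
  whenever \<open>x\<^sub>i\<close> does not occur in \<open>m\<close>.\<close>

definition pdiff :: "nat \<Rightarrow> 'a::field_char_0 mpoly \<Rightarrow> 'a mpoly" where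
  "pdiff i p = (\<Sum>m\<in>Poly_Mapping.keys p.
     Poly_Mapping.single (m - Poly_Mapping.single i 1)
       (of_nat (Poly_Mapping.lookup m i) * Poly_Mapping.lookup p m))"

text \<open>A linear map on \<open>Pol n\<close> is represented by the function on the whole polynomial type
  that extends it by \<open>0\<close>. Sums and multiples of such maps are then pointwise, and equality of
  functions is equality of maps on \<open>Pol n\<close>.\<close>

definition Der :: "nat \<Rightarrow> ('a::field_char_0 mpoly \<Rightarrow> 'a mpoly) set" where
  "Der n = {D. linear_map_on pscale pscale (Pol n) (Pol n) D \<and>
     (\<forall>p\<in>Pol n. \<forall>q\<in>Pol n. D (p * q) = D p * q + p * D q) \<and>
     (\<forall>p. p \<notin> Pol n \<longrightarrow> D p = 0)}"

definition dscale ::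
  "'a::field_char_0 \<Rightarrow> ('a mpoly \<Rightarrow> 'a mpoly) \<Rightarrow> 'a mpoly \<Rightarrow> 'a mpoly" where
  "dscale c D = (\<lambda>p. pscale c (D p))"

definition commutator ::
  "('a::field_char_0 mpoly \<Rightarrow> 'a mpoly) \<Rightarrow> ('a mpoly \<Rightarrow> 'a mpoly) \<Rightarrow> 'a mpoly \<Rightarrow> 'a mpoly" where
  "commutator D E = (D \<circ> E) - (E \<circ> D)"

definition partial :: "nat \<Rightarrow> nat \<Rightarrow> 'a::field_char_0 mpoly \<Rightarrow> 'a mpoly" where
  "partial n i = (\<lambda>p. if p \<in> Pol n then pdiff i p else 0)"

text \<open>With \<open>Pol\<close> and \<open>partial\<close> as \<open>P\<close> and \<open>\<partial>\<close>, \<open>tri n\<close> is \<open>\<uu>\<^sub>n\<close> and, for \<open>i \<ge> 1\<close>, \<open>tri_ideal n i\<close> is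
  \<open>\<uu>\<close> with index \<open>n,i\<close>. For \<open>i > n\<close> the sum is empty, so that \<open>tri_ideal n i = {0}\<close>.\<close>

definition tri_ideal :: "nat \<Rightarrow> nat \<Rightarrow> ('a::field_char_0 mpoly \<Rightarrow> 'a mpoly) set" where
  "tri_ideal n i = {\<Sum>j=i..n. (\<lambda>p. a j * partial n j p) | a. \<forall>j\<in>{i..n}. a j \<in> Pol (j - 1)}"

definition tri :: "nat \<Rightarrow> ('a::field_char_0 mpoly \<Rightarrow> 'a mpoly) set" where
  "tri n = {\<Sum>j=1..n. (\<lambda>p. a j * partial n j p) | a. \<forall>j\<in>{1..n}. a j \<in> Pol (j - 1)}"


section \<open>Well-formedness of the definitions\<close>

lemma sum_fun_apply: "(\<Sum>i\<in>A. f i) x = (\<Sum>i\<in>A. f i x)"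
  for f :: "'i \<Rightarrow> 'b \<Rightarrow> 'c::comm_monoid_add"
  by (induction A rule: infinite_finite_induct) auto

lemma lookup_pdiff:
  "Poly_Mapping.lookup (pdiff i p) m =
     of_nat (Suc (Poly_Mapping.lookup m i)) * Poly_Mapping.lookup p (m + Poly_Mapping.single i 1)"
proof -
  let ?s = "Poly_Mapping.single i (1::nat)"
  have key: "(of_nat (Poly_Mapping.lookup k i) * c when k - ?s = m) =
      (of_nat (Poly_Mapping.lookup k i) * c when k = m + ?s)" for k and c :: 'a
  proof (cases "Poly_Mapping.lookup k i = 0")
    case False
    have "k - ?s = m \<longleftrightarrow> k = m + ?s"
    proof
      assume "k - ?s = m"
      then have "Poly_Mapping.lookup (m + ?s) x = Poly_Mapping.lookup k x" for x
        using False by (cases "x = i") (auto simp: lookup_add lookup_minus lookup_single)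
      then show "k = m + ?s" by (metis poly_mapping_eqI)
    qed simp
    then show ?thesis by simp
  qed (simp add: when_def)
  have "Poly_Mapping.lookup (pdiff i p) m =
     (\<Sum>k\<in>Poly_Mapping.keys p. of_nat (Poly_Mapping.lookup k i) * Poly_Mapping.lookup p k when k - ?s = m)"
    by (simp add: pdiff_def lookup_sum lookup_single)
  also have "\<dots> = (\<Sum>k\<in>Poly_Mapping.keys p. if k = m + ?s then of_nat (Poly_Mapping.lookup k i) * Poly_Mapping.lookup p k else 0)"
    unfolding when_def by (rule sum.cong[OF refl], rule key[unfolded when_def])
  also have "\<dots> = of_nat (Suc (Poly_Mapping.lookup m i)) * Poly_Mapping.lookup p (m + ?s)"
    by (simp add: lookup_add in_keys_iff)
  finally show ?thesis .
qed

lemma pdiff_add: "pdiff i (p + q) = pdiff i p + pdiff i q"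
  by (rule poly_mapping_eqI) (simp add: lookup_pdiff lookup_add algebra_simps)

lemma pdiff_0 [simp]: "pdiff i 0 = 0"
  by (simp add: pdiff_def)

lemma pdiff_uminus: "pdiff i (- p) = - pdiff i p"
  by (metis add.right_inverse add_eq_0_iff pdiff_0 pdiff_add)

lemma pdiff_diff: "pdiff i (p - q) = pdiff i p - pdiff i q"
  by (metis diff_conv_add_uminus pdiff_add pdiff_uminus)

lemma pdiff_sum: "pdiff i (\<Sum>j\<in>A. f j) = (\<Sum>j\<in>A. pdiff i (f j))"
  by (induction A rule: infinite_finite_induct) (auto simp: pdiff_add)

lemma pdiff_single:
  "pdiff i (Poly_Mapping.single m c) =
     Poly_Mapping.single (m - Poly_Mapping.single i 1) (of_nat (Poly_Mapping.lookup m i) * c)"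
  by (cases "c = 0") (simp_all add: pdiff_def)

lemma pdiff_commute: "pdiff i (pdiff j p) = pdiff j (pdiff i p)"
  by (rule poly_mapping_eqI)
     (simp add: lookup_pdiff lookup_add lookup_single when_def add.assoc add.commute add.left_commute)

lemma mpoly_induct:
  assumes "\<And>m c. Q (Poly_Mapping.single m c)" and "\<And>p q. Q p \<Longrightarrow> Q q \<Longrightarrow> Q (p + q)"
  shows "Q (p :: 'a::field_char_0 mpoly)"
proof (induction p rule: update_induct)
  case const
  then show ?case using assms(1)[of 0 0] by simp
next
  case (update f a b)
  have "Poly_Mapping.update a b f = f + Poly_Mapping.single a b"
    using update(1)
    by (intro poly_mapping_eqI) (auto simp: lookup_update lookup_add lookup_single in_keys_iff)
  then show ?case using assms update by simp
qed

lemma pdiff_mult: "pdiff i (p * q) = pdiff i p * q + p * pdiff i q"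
proof (induction p rule: mpoly_induct)
  case (1 m c)
  show ?case
  proof (induction q rule: mpoly_induct)
    case (1 k d)
    let ?s = "Poly_Mapping.single i (1::nat)"
    have a: "m + k - ?s = (m - ?s) + k" if "Poly_Mapping.lookup m i \<noteq> 0" for m k
    proof (rule poly_mapping_eqI)
      fix x show "Poly_Mapping.lookup (m + k - ?s) x = Poly_Mapping.lookup ((m - ?s) + k) x"
        using that by (cases "x = i") (auto simp: lookup_add lookup_minus lookup_single)
    qed
    consider "Poly_Mapping.lookup m i \<noteq> 0" "Poly_Mapping.lookup k i \<noteq> 0"
      | "Poly_Mapping.lookup m i = 0" "Poly_Mapping.lookup k i \<noteq> 0"
      | "Poly_Mapping.lookup m i \<noteq> 0" "Poly_Mapping.lookup k i = 0"
      | "Poly_Mapping.lookup m i = 0" "Poly_Mapping.lookup k i = 0" by blast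
    then show ?case
    proof cases
      case 1
      have e: "(m - ?s) + k = m + k - ?s" "m + (k - ?s) = m + k - ?s"
        using a[OF 1(1), of k] a[OF 1(2), of m] by (simp_all only: add.commute)
      show ?thesis
        by (simp only: mult_single pdiff_single lookup_add e single_add[symmetric])
          (simp add: algebra_simps)
    next
      case 2
      have e: "m + (k - ?s) = m + k - ?s"
        using a[OF 2(2), of m] by (simp only: add.commute)
      show ?thesis
        by (simp only: mult_single pdiff_single lookup_add e 2(1))
          (simp add: algebra_simps)
    next
      case 3
      have e: "(m - ?s) + k = m + k - ?s"
        using a[OF 3(1), of k] by simp
      show ?thesis
        by (simp only: mult_single pdiff_single lookup_add e 3(2))
          (simp add: algebra_simps)
    next
      case 4
      then show ?thesis by (simp add: mult_single pdiff_single lookup_add)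
    qed
  qed (simp add: pdiff_add algebra_simps)
qed (simp add: pdiff_add algebra_simps)

lemma pdiff_pscale: "pdiff i (pscale c p) = pscale c (pdiff i p)"
  by (simp add: pscale_def pdiff_mult pdiff_single)

lemma Pol_0 [simp]: "0 \<in> Pol i"
  by (simp add: Pol_def)

lemma Pol_add: "p \<in> Pol i \<Longrightarrow> q \<in> Pol i \<Longrightarrow> p + q \<in> Pol i"
  using Poly_Mapping.keys_add[of p q] by (auto simp: Pol_def)

lemma Pol_mult:
  assumes p: "p \<in> Pol i" and q: "q \<in> Pol i"
  shows "p * q \<in> Pol i"
  unfolding Pol_def
proof (rule CollectI, rule ballI)
  fix m assume "m \<in> Poly_Mapping.keys (p * q)"
  then obtain a b where "m = a + b" "a \<in> Poly_Mapping.keys p" "b \<in> Poly_Mapping.keys q"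
    using keys_mult[of p q] by blast
  moreover from this have "Poly_Mapping.keys a \<subseteq> {1..i}" "Poly_Mapping.keys b \<subseteq> {1..i}"
    using p q by (simp_all add: Pol_def)
  ultimately show "Poly_Mapping.keys m \<subseteq> {1..i}"
    using Poly_Mapping.keys_add[of a b] by blast
qed

lemma Pol_single0: "Poly_Mapping.single 0 c \<in> Pol i"
  by (simp add: Pol_def)

lemma Pol_pscale: "p \<in> Pol i \<Longrightarrow> pscale c p \<in> Pol i"
  by (simp add: pscale_def Pol_mult Pol_single0)

lemma Pol_uminus: "p \<in> Pol i \<Longrightarrow> - p \<in> Pol i"
  by (simp add: Pol_def)

lemma Pol_diff: "p \<in> Pol i \<Longrightarrow> q \<in> Pol i \<Longrightarrow> p - q \<in> Pol i"
  by (metis Pol_add Pol_uminus diff_conv_add_uminus)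

lemma Pol_sum: "(\<And>j. j \<in> A \<Longrightarrow> f j \<in> Pol i) \<Longrightarrow> (\<Sum>j\<in>A. f j) \<in> Pol i"
  by (induction A rule: infinite_finite_induct) (auto simp: Pol_add)

lemma Pol_mono: "i \<le> j \<Longrightarrow> p \<in> Pol i \<Longrightarrow> p \<in> Pol j"
  by (fastforce simp: Pol_def)

lemma Pol_pdiff:
  assumes "p \<in> Pol j" shows "pdiff i p \<in> Pol j"
  unfolding Pol_def
proof safe
  fix m x
  assume "m \<in> Poly_Mapping.keys (pdiff i p)" and x: "x \<in> Poly_Mapping.keys m"
  then have "m + Poly_Mapping.single i 1 \<in> Poly_Mapping.keys p"
    by (auto simp: in_keys_iff lookup_pdiff)
  then have "Poly_Mapping.keys (m + Poly_Mapping.single i 1) \<subseteq> {1..j}"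
    using assms by (auto simp: Pol_def)
  moreover have "x \<in> Poly_Mapping.keys (m + Poly_Mapping.single i 1)"
    using x by (auto simp: in_keys_iff lookup_add)
  ultimately show "x \<in> {1..j}" by blast
qed

lemma pdiff_eq_0:
  assumes "p \<in> Pol j" "j < i" shows "pdiff i p = 0"
proof (rule poly_mapping_eqI)
  fix m :: "nat \<Rightarrow>\<^sub>0 nat"
  have "i \<in> Poly_Mapping.keys (m + Poly_Mapping.single i 1)"
    by (simp add: in_keys_iff lookup_add)
  then have "m + Poly_Mapping.single i 1 \<notin> Poly_Mapping.keys p"
    using assms by (force simp: Pol_def)
  then show "Poly_Mapping.lookup (pdiff i p) m = Poly_Mapping.lookup 0 m"
    by (simp add: lookup_pdiff in_keys_iff)
qed

lemma pscale_simps: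
  "pscale c (p + q) = pscale c p + pscale c q"
  "pscale (c + d) p = pscale c p + pscale d p"
  "pscale c (pscale d p) = pscale (c * d) p"
  "pscale 1 p = p"
  "pscale c (p - q) = pscale c p - pscale c q"
  "pscale c 0 = 0"
  "pscale c p * q = pscale c (p * q)"
  "p * pscale c q = pscale c (p * q)"
  by (simp_all add: pscale_def algebra_simps single_add mult_single flip: mult.assoc)

interpretation dvs: vector_space dscale
  by standard (auto simp: dscale_def pscale_simps fun_eq_iff)

lemma DerD:
  assumes "D \<in> Der n"
  shows "p \<in> Pol n \<Longrightarrow> D p \<in> Pol n"
    and "p \<in> Pol n \<Longrightarrow> q \<in> Pol n \<Longrightarrow> D (p + q) = D p + D q"
    and "p \<in> Pol n \<Longrightarrow> D (pscale c p) = pscale c (D p)"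
    and "p \<in> Pol n \<Longrightarrow> q \<in> Pol n \<Longrightarrow> D (p * q) = D p * q + p * D q"
    and "p \<notin> Pol n \<Longrightarrow> D p = 0"
    and "D 0 = 0"
    and "p \<in> Pol n \<Longrightarrow> q \<in> Pol n \<Longrightarrow> D (p - q) = D p - D q"
proof -
  show 1: "p \<in> Pol n \<Longrightarrow> D p \<in> Pol n" "p \<in> Pol n \<Longrightarrow> D (pscale c p) = pscale c (D p)"
    "p \<in> Pol n \<Longrightarrow> q \<in> Pol n \<Longrightarrow> D (p * q) = D p * q + p * D q"
    "p \<notin> Pol n \<Longrightarrow> D p = 0" for p q c
    using assms by (auto simp: Der_def linear_map_on_def)
  show 2: "p \<in> Pol n \<Longrightarrow> q \<in> Pol n \<Longrightarrow> D (p + q) = D p + D q" for p q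
    using assms by (auto simp: Der_def linear_map_on_def)
  show "D 0 = 0" using 2[of 0 0] by simp
  show "p \<in> Pol n \<Longrightarrow> q \<in> Pol n \<Longrightarrow> D (p - q) = D p - D q"
    using 2[of "p - q" q] Pol_diff[of p n q] by (simp add: algebra_simps)
qed

lemma DerI:
  assumes "\<And>p. p \<in> Pol n \<Longrightarrow> D p \<in> Pol n"
    and "\<And>p q. p \<in> Pol n \<Longrightarrow> q \<in> Pol n \<Longrightarrow> D (p + q) = D p + D q"
    and "\<And>c p. p \<in> Pol n \<Longrightarrow> D (pscale c p) = pscale c (D p)"
    and "\<And>p q. p \<in> Pol n \<Longrightarrow> q \<in> Pol n \<Longrightarrow> D (p * q) = D p * q + p * D q"
    and "\<And>p. p \<notin> Pol n \<Longrightarrow> D p = 0"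
  shows "D \<in> Der n"
  using assms by (auto simp: Der_def linear_map_on_def)

lemma commutator_apply: "commutator D E p = D (E p) - E (D p)"
  by (simp add: commutator_def)

lemma Der_eqI:
  assumes "D \<in> Der n" "E \<in> Der n" "\<And>p. p \<in> Pol n \<Longrightarrow> D p = E p"
  shows "D = E"
  by (metis DerD(5) assms ext)

lemma Der_subspace: "dvs.subspace (Der n)"
proof (rule dvs.subspaceI)
  show "0 \<in> Der n"
    by (rule DerI) (simp_all add: pscale_simps)
next
  fix D E :: "'a mpoly_map" assume D: "D \<in> Der n" and E: "E \<in> Der n"
  show "D + E \<in> Der n"
    by (rule DerI) (simp_all add: DerD[OF D] DerD[OF E] Pol_add pscale_simps algebra_simps)
next
  fix c and D :: "'a mpoly_map" assume D: "D \<in> Der n"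
  show "dscale c D \<in> Der n"
    by (rule DerI)
      (simp_all add: DerD[OF D] dscale_def Pol_pscale pscale_simps algebra_simps)
qed

lemma Der_commutator:
  assumes D: "D \<in> Der n" and E: "E \<in> Der n"
  shows "commutator D E \<in> Der n"
proof (rule DerI)
  fix p :: "'a mpoly" assume p: "p \<in> Pol n"
  show "commutator D E p \<in> Pol n"
    using p by (simp add: commutator_apply DerD[OF D] DerD[OF E] Pol_diff)
  show "commutator D E (pscale c p) = pscale c (commutator D E p)" for c
    using p by (simp add: commutator_apply DerD[OF D] DerD[OF E] pscale_simps)
  fix q :: "'a mpoly" assume q: "q \<in> Pol n"
  show "commutator D E (p + q) = commutator D E p + commutator D E q"
    using p q by (simp add: commutator_apply DerD[OF D] DerD[OF E])
  show "commutator D E (p * q) = commutator D E p * q + p * commutator D E q"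
    using p q
    by (simp add: commutator_apply DerD[OF D] DerD[OF E] Pol_mult) (simp add: algebra_simps)
next
  fix p :: "'a mpoly" assume "p \<notin> Pol n"
  then show "commutator D E p = 0"
    by (simp add: commutator_apply DerD[OF D] DerD[OF E])
qed

proposition lie_algebra_Der: "lie_algebra dscale commutator (Der n)"
proof
  show "dvs.subspace (Der n)" by (rule Der_subspace)
next
  fix D E :: "'a mpoly_map" and c
  assume D: "D \<in> Der n" and E: "E \<in> Der n"
  note mem = D E Der_commutator dvs.subspace_add[OF Der_subspace] dvs.subspace_scale[OF Der_subspace]
    dvs.subspace_0[OF Der_subspace]
  show "commutator D E \<in> Der n" by (rule Der_commutator[OF D E])
  show "commutator D D = 0" by (simp add: commutator_def)
  show "commutator (dscale c D) E = dscale c (commutator D E)"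
    by (rule Der_eqI[of _ n]; (intro mem)?)
      (simp add: commutator_apply dscale_def DerD[OF D] DerD[OF E] pscale_simps)
  show "commutator D (dscale c E) = dscale c (commutator D E)"
    by (rule Der_eqI[of _ n]; (intro mem)?)
      (simp add: commutator_apply dscale_def DerD[OF D] DerD[OF E] pscale_simps)
  fix F :: "'a mpoly_map" assume F: "F \<in> Der n"
  note mem = mem F
  show "commutator (D + E) F = commutator D F + commutator E F"
    by (rule Der_eqI[of _ n]; (intro mem)?)
      (simp add: commutator_apply DerD[OF D] DerD[OF E] DerD[OF F])
  show "commutator D (E + F) = commutator D E + commutator D F"
    by (rule Der_eqI[of _ n]; (intro mem)?)
      (simp add: commutator_apply DerD[OF D] DerD[OF E] DerD[OF F])
  show "commutator D (commutator E F) + commutator E (commutator F D) +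
      commutator F (commutator D E) = 0"
    by (rule Der_eqI[of _ n]; (intro mem)?)
      (simp add: commutator_apply DerD[OF D] DerD[OF E] DerD[OF F])
qed

lemma tri_eq: "tri n = tri_ideal n 1"
  by (simp add: tri_def tri_ideal_def)

lemma tri_ideal_iff:
  "D \<in> tri_ideal n i \<longleftrightarrow> (\<exists>a. (\<forall>j\<in>{i..n}. a j \<in> Pol (j - 1)) \<and>
     D = (\<lambda>p. if p \<in> Pol n then \<Sum>j=i..n. a j * pdiff j p else 0))"
proof -
  have "(\<Sum>j=i..n. (\<lambda>p. a j * partial n j p)) =
      (\<lambda>p. if p \<in> Pol n then \<Sum>j=i..n. a j * pdiff j p else 0)" for a :: "nat \<Rightarrow> 'a mpoly"
    by (rule ext) (simp add: sum_fun_apply partial_def)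
  then show ?thesis by (auto simp: tri_ideal_def)
qed

lemma tri_subset_Der: "tri n \<subseteq> Der n"
proof
  fix D :: "'a mpoly \<Rightarrow> 'a mpoly"
  assume "D \<in> tri n"
  then obtain a where a: "\<forall>j\<in>{1..n}. a j \<in> Pol (j - 1)"
    and D: "D = (\<lambda>p. if p \<in> Pol n then \<Sum>j=1..n. a j * pdiff j p else 0)"
    unfolding tri_eq tri_ideal_iff by blast
  have a': "a j \<in> Pol n" if "j \<in> {1..n}" for j
    using a that by (auto intro: Pol_mono[of "j - 1"])
  show "D \<in> Der n"
  proof (rule DerI)
    fix p :: "'a mpoly" assume p: "p \<in> Pol n"
    show "D p \<in> Pol n"
      using p a' by (auto simp: D intro!: Pol_sum Pol_mult Pol_pdiff)
    show "D (pscale c p) = pscale c (D p)" for c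
      using p by (simp add: D Pol_pscale pdiff_pscale pscale_simps)
        (simp add: pscale_def sum_distrib_left)
    fix q :: "'a mpoly" assume q: "q \<in> Pol n"
    show "D (p + q) = D p + D q"
      using p q by (simp add: D Pol_add pdiff_add sum.distrib algebra_simps)
    show "D (p * q) = D p * q + p * D q"
      using p q by (simp add: D Pol_mult pdiff_mult sum.distrib algebra_simps sum_distrib_left)
  qed (simp add: D)
qed

lemma tri_subspace: "dvs.subspace (tri n)"
proof (rule dvs.subspaceI)
  show "0 \<in> tri n"
    unfolding tri_eq tri_ideal_iff
    by (rule exI[of _ "\<lambda>_. 0"]) (simp add: fun_eq_iff)
next
  fix D E :: "'a mpoly \<Rightarrow> 'a mpoly"
  assume "D \<in> tri n" "E \<in> tri n"
  then obtain a b where "\<forall>j\<in>{1..n}. a j \<in> Pol (j - 1)" "\<forall>j\<in>{1..n}. b j \<in> Pol (j - 1)"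
    and "D = (\<lambda>p. if p \<in> Pol n then \<Sum>j=1..n. a j * pdiff j p else 0)"
    and "E = (\<lambda>p. if p \<in> Pol n then \<Sum>j=1..n. b j * pdiff j p else 0)"
    unfolding tri_eq tri_ideal_iff by blast
  then show "D + E \<in> tri n"
    unfolding tri_eq tri_ideal_iff
    by (intro exI[of _ "\<lambda>j. a j + b j"])
      (auto simp: fun_eq_iff Pol_add distrib_right sum.distrib)
next
  fix c and D :: "'a mpoly \<Rightarrow> 'a mpoly"
  assume "D \<in> tri n"
  then obtain a where "\<forall>j\<in>{1..n}. a j \<in> Pol (j - 1)"
    and "D = (\<lambda>p. if p \<in> Pol n then \<Sum>j=1..n. a j * pdiff j p else 0)"
    unfolding tri_eq tri_ideal_iff by blast
  then show "dscale c D \<in> tri n"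
    unfolding tri_eq tri_ideal_iff
    by (intro exI[of _ "\<lambda>j. pscale c (a j)"])
      (auto simp: fun_eq_iff dscale_def Pol_mult Pol_single0 pscale_def sum_distrib_left mult.assoc)
qed

lemma tri_commutator:
  fixes D E :: "'a::field_char_0 mpoly \<Rightarrow> 'a mpoly"
  assumes "D \<in> tri n" "E \<in> tri n"
  shows "commutator D E \<in> tri n"
proof -
  obtain a b where a: "\<forall>j\<in>{1..n}. a j \<in> Pol (j - 1)" and b: "\<forall>j\<in>{1..n}. b j \<in> Pol (j - 1)"
    and D: "D = (\<lambda>p. if p \<in> Pol n then \<Sum>j=1..n. a j * pdiff j p else 0)"
    and E: "E = (\<lambda>p. if p \<in> Pol n then \<Sum>j=1..n. b j * pdiff j p else 0)"
    using assms unfolding tri_eq tri_ideal_iff by blast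
  define c where "c j = (\<Sum>k=1..n. a k * pdiff k (b j) - b k * pdiff k (a j))" for j
  have mem: "f k * pdiff k (g j) \<in> Pol (j - 1)"
    if "\<forall>j\<in>{1..n}. f j \<in> Pol (j - 1)" "\<forall>j\<in>{1..n}. g j \<in> Pol (j - 1)" "j \<in> {1..n}" "k \<in> {1..n}"
    for f g :: "nat \<Rightarrow> 'a mpoly" and j k
  proof (cases "k \<le> j - 1")
    case True
    then have "f k \<in> Pol (j - 1)" using that by (auto intro: Pol_mono[of "k - 1"])
    then show ?thesis using that by (simp add: Pol_mult Pol_pdiff)
  next
    case False
    then have "pdiff k (g j) = 0" using that by (intro pdiff_eq_0[of _ "j - 1"]) auto
    then show ?thesis by simp
  qed
  have c: "\<forall>j\<in>{1..n}. c j \<in> Pol (j - 1)"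
    unfolding c_def using a b by (intro ballI Pol_sum Pol_diff mem) auto
  have in_n: "(\<Sum>j=1..n. f j * pdiff j p) \<in> Pol n"
    if "\<forall>j\<in>{1..n}. f j \<in> Pol (j - 1)" "p \<in> Pol n" for f and p :: "'a mpoly"
    using that Pol_mono[OF _ that(1)[rule_format]] by (intro Pol_sum Pol_mult Pol_pdiff) auto
  have "commutator D E p = (if p \<in> Pol n then \<Sum>j=1..n. c j * pdiff j p else 0)" for p
  proof (cases "p \<in> Pol n")
    case True
    have exp: "(\<Sum>k=1..n. f k * pdiff k (\<Sum>j=1..n. g j * pdiff j p)) =
        (\<Sum>j=1..n. \<Sum>k=1..n. f k * pdiff k (g j) * pdiff j p) +
        (\<Sum>j=1..n. \<Sum>k=1..n. f k * g j * pdiff k (pdiff j p))" for f g :: "nat \<Rightarrow> 'a mpoly"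
      by (subst sum.swap, subst (2) sum.swap)
        (simp add: pdiff_sum pdiff_mult sum_distrib_left sum.distrib algebra_simps)
    have swap: "(\<Sum>j=1..n. \<Sum>k=1..n. a k * b j * pdiff k (pdiff j p)) =
        (\<Sum>j=1..n. \<Sum>k=1..n. b k * a j * pdiff k (pdiff j p))"
      by (subst sum.swap) (simp add: pdiff_commute mult.commute)
    have "commutator D E p = (\<Sum>k=1..n. a k * pdiff k (\<Sum>j=1..n. b j * pdiff j p)) -
        (\<Sum>k=1..n. b k * pdiff k (\<Sum>j=1..n. a j * pdiff j p))"
      using True in_n[OF a True] in_n[OF b True] by (simp add: commutator_apply D E)
    also have "\<dots> = (\<Sum>j=1..n. c j * pdiff j p)"
      by (simp only: exp swap)
        (simp add: c_def sum_distrib_right left_diff_distrib sum_subtractf)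
    finally show ?thesis
      using True by simp
  next
    case False
    then show ?thesis by (simp add: commutator_apply D E)
  qed
  then show ?thesis
    unfolding tri_eq tri_ideal_iff using c by blast
qed

proposition lie_algebra_tri: "lie_algebra dscale commutator (tri n)"
proof -
  interpret D: lie_algebra dscale commutator "Der n" by (rule lie_algebra_Der)
  show ?thesis
    using tri_subset_Der[of n]
    by unfold_locales
      (auto simp: tri_subspace tri_commutator subset_iff D.br_add_left D.br_add_right
        D.br_scale_left D.br_scale_right D.br_self D.jacobi)
qed

end

theory Submission
  imports Defs
begin

text \<open>
  A triangular derivation \<open>D\<close> is determined by its coordinates \<open>D x\<^sub>j\<close>, where \<open>D x\<^sub>j\<close> may be any element
  of \<open>P\<^bsub>j-1\<^esub>\<close>, and \<open>tri_ideal n i\<close> consists of those \<open>D\<close> that kill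
  \<open>x\<^sub>1, \<dots>, x\<^bsub>i-1\<^esub>\<close>, hence all of \<open>P\<^bsub>i-1\<^esub>\<close>
  (\<open>tri_ideal_iff_Var\<close>, \<open>tri_ideal_kills_Pol\<close>). Everything is read off from these coordinates.

  Both series rest on two facts. If \<open>D\<close> and \<open>E\<close> kill \<open>P\<^bsub>i-1\<^esub>\<close>, then \<open>D x\<^sub>i\<close> and \<open>E x\<^sub>i\<close> lie in
  \<open>P\<^bsub>i-1\<^esub>\<close>, so that \<open>[D,E]\<close> kills \<open>x\<^sub>i\<close> too (\<open>commutator_in_tri_ideal_Suc\<close>). Conversely, in
  characteristic zero every polynomial has an antiderivative with respect to \<open>x\<^sub>i\<close>; integrating the
  coordinates one by one shows that \<open>[\<partial>\<^sub>i, _]\<close> maps \<open>tri_ideal n (i + 1)\<close> onto itself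
  (\<open>commutator_partial_surj\<close>). So \<open>[\<uu>\<^bsub>n,i\<^esub>, \<uu>\<^bsub>n,i\<^esub>] = \<uu>\<^bsub>n,i+1\<^esub>\<close>, and with \<open>i = 1\<close> also
  \<open>[\<uu>\<^sub>n, \<uu>\<^bsub>n,2\<^esub>] = \<uu>\<^bsub>n,2\<^esub>\<close>, which is nonzero for \<open>n \<ge> 2\<close>.

  For local nilpotence on \<open>P\<^sub>n\<close>, the Leibniz rule makes the polynomials killed by a power of \<open>D\<close> a
  subalgebra; it contains \<open>x\<^sub>j\<close> as soon as it contains \<open>P\<^bsub>j-1\<^esub>\<close>, where \<open>D x\<^sub>j\<close> lies
  (\<open>tri_nilpotent_at\<close>). The evaluation \<open>(E, p) \<mapsto> E p\<close> satisfies a Leibniz rule as well, namely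
  \<open>D (E p) = [D,E] p + E (D p)\<close>, and this carries nilpotence over to \<open>ad D\<close>
  (\<open>ad_funpow_apply_eq_0\<close>); it suffices to evaluate at the finitely many variables.

  A central element commutes with \<open>x\<^sub>i \<partial>\<^bsub>i+1\<^esub>\<close>, which kills its coordinates below \<open>n\<close>, and with all
  \<open>\<partial>\<^sub>i\<close>, which makes its last coordinate constant (\<open>lie_centre_tri\<close>). Finally, an isomorphism
  carries derived series to derived series, and that of \<open>\<uu>\<^sub>n\<close> reaches \<open>0\<close> after exactly \<open>n\<close> steps,
  so \<open>n\<close> is an isomorphism invariant (\<open>tri_not_isomorphic\<close>).
\<close>

section \<open>Variables, antiderivatives and constants\<close>

definition Var :: "nat \<Rightarrow> 'a::field_char_0 mpoly" where
  "Var i = Poly_Mapping.single (Poly_Mapping.single i 1) 1"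

text \<open>The antiderivative with respect to \<open>x\<^sub>i\<close> that has no term free of \<open>x\<^sub>i\<close>. Characteristic zero
  makes the denominators nonzero.\<close>
definition antidiff :: "nat \<Rightarrow> 'a::field_char_0 mpoly \<Rightarrow> 'a mpoly" where
  "antidiff i p = (\<Sum>m\<in>Poly_Mapping.keys p.
     Poly_Mapping.single (m + Poly_Mapping.single i 1)
       (Poly_Mapping.lookup p m / of_nat (Suc (Poly_Mapping.lookup m i))))"

lemma Var_in_Pol_iff: "Var i \<in> Pol n \<longleftrightarrow> i \<in> {1..n}"
  by (simp add: Var_def Pol_def)

lemma pdiff_Var: "pdiff i (Var j) = (if i = j then 1 else 0)"
  by (simp add: Var_def pdiff_single lookup_single)

lemma pdiff_antidiff: "pdiff i (antidiff i p) = p"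
proof (rule poly_mapping_eqI)
  fix m
  show "Poly_Mapping.lookup (pdiff i (antidiff i p)) m = Poly_Mapping.lookup p m"
    by (simp add: lookup_pdiff antidiff_def lookup_sum lookup_single lookup_add when_def
        in_keys_iff del: of_nat_Suc)
qed

lemma Pol_antidiff:
  assumes "p \<in> Pol j" "i \<in> {1..j}"
  shows "antidiff i p \<in> Pol j"
  unfolding antidiff_def
proof (rule Pol_sum)
  fix m assume "m \<in> Poly_Mapping.keys p"
  then have "Poly_Mapping.keys m \<subseteq> {1..j}" using assms by (simp add: Pol_def)
  then have "Poly_Mapping.keys (m + Poly_Mapping.single i 1) \<subseteq> {1..j}"
    using Poly_Mapping.keys_add[of m "Poly_Mapping.single i 1"] assms by auto
  then show "Poly_Mapping.single (m + Poly_Mapping.single i 1)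
      (Poly_Mapping.lookup p m / of_nat (Suc (Poly_Mapping.lookup m i))) \<in> Pol j"
    by (simp add: Pol_def)
qed

lemma constant_if_pdiff_eq_0:
  fixes p :: "'a::field_char_0 mpoly"
  assumes "p \<in> Pol n" and "\<And>i. i \<in> {1..n} \<Longrightarrow> pdiff i p = 0"
  shows "\<exists>c. p = pscale c 1"
proof
  show "p = pscale (Poly_Mapping.lookup p 0) 1"
  proof (rule poly_mapping_eqI)
    fix m
    show "Poly_Mapping.lookup p m = Poly_Mapping.lookup (pscale (Poly_Mapping.lookup p 0) 1) m"
    proof (cases "m = 0")
      case False
      have "Poly_Mapping.lookup p m = 0"
      proof (rule ccontr)
        assume nz: "Poly_Mapping.lookup p m \<noteq> 0"
        then have sub: "Poly_Mapping.keys m \<subseteq> {1..n}"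
          using assms(1) by (simp add: Pol_def in_keys_iff)
        obtain i where i: "i \<in> Poly_Mapping.keys m" using False by fastforce
        define k where "k = m - Poly_Mapping.single i 1"
        have "m = k + Poly_Mapping.single i 1"
          using i by (intro poly_mapping_eqI)
            (auto simp: k_def lookup_add lookup_minus lookup_single when_def in_keys_iff)
        then have "Poly_Mapping.lookup (pdiff i p) k \<noteq> 0"
          using nz by (simp add: lookup_pdiff del: of_nat_Suc)
        then show False using assms(2)[of i] i sub by auto
      qed
      then show ?thesis using False by (simp add: pscale_def lookup_single when_def)
    qed (simp add: pscale_def)
  qed
qed

text \<open>\<open>P\<^sub>n\<close> is generated as an algebra by the constants and \<open>x\<^sub>1, \<dots>, x\<^sub>n\<close>: split one variable off a
  monomial at a time, by induction on the total degree, and write a polynomial as the sum of its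
  terms.\<close>
lemma Pol_generated_by_Var:
  fixes p :: "'a::field_char_0 mpoly"
  assumes p: "p \<in> Pol n"
    and const: "\<And>c. Q (Poly_Mapping.single 0 c)"
    and var: "\<And>i. i \<in> {1..n} \<Longrightarrow> Q (Var i)"
    and add: "\<And>p q. p \<in> Pol n \<Longrightarrow> q \<in> Pol n \<Longrightarrow> Q p \<Longrightarrow> Q q \<Longrightarrow> Q (p + q)"
    and mult: "\<And>p q. p \<in> Pol n \<Longrightarrow> q \<in> Pol n \<Longrightarrow> Q p \<Longrightarrow> Q q \<Longrightarrow> Q (p * q)"
  shows "Q p"
proof -
  have mono: "Q (Poly_Mapping.single m c)"
    if "Poly_Mapping.keys m \<subseteq> {1..n}" for m and c :: 'a
    using that
  proof (induction "\<Sum>i\<in>Poly_Mapping.keys m. Poly_Mapping.lookup m i" arbitrary: m rule: less_induct)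
    case less
    show ?case
    proof (cases "m = 0")
      case False
      then obtain i where i: "i \<in> Poly_Mapping.keys m" by fastforce
      define k where "k = m - Poly_Mapping.single i 1"
      have m: "m = Poly_Mapping.single i 1 + k"
        using i by (intro poly_mapping_eqI)
          (auto simp: k_def lookup_add lookup_minus lookup_single when_def in_keys_iff)
      have keys: "Poly_Mapping.keys k \<subseteq> Poly_Mapping.keys m"
        by (auto simp: k_def in_keys_iff lookup_minus)
      have "(\<Sum>j\<in>Poly_Mapping.keys k. Poly_Mapping.lookup k j) =
          (\<Sum>j\<in>Poly_Mapping.keys m. Poly_Mapping.lookup k j)"
        using keys by (intro sum.mono_neutral_left) (auto simp: in_keys_iff)
      also have "\<dots> < (\<Sum>j\<in>Poly_Mapping.keys m. Poly_Mapping.lookup m j)"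
        using i by (intro sum_strict_mono_ex1)
          (auto simp: k_def lookup_minus lookup_single in_keys_iff intro!: bexI[of _ i])
      finally have "Q (Poly_Mapping.single k c)"
        using less keys by blast
      moreover have "Poly_Mapping.single k c \<in> Pol n" "i \<in> {1..n}"
        using keys less(2) i by (auto simp: Pol_def)
      ultimately have "Q (Var i * Poly_Mapping.single k c)"
        by (intro mult var) (simp_all add: Var_in_Pol_iff)
      then show ?thesis
        unfolding m by (simp add: Var_def mult_single)
    qed (simp add: const)
  qed
  have fin: "Q (\<Sum>m\<in>A. Poly_Mapping.single m (Poly_Mapping.lookup p m))"
    if "finite A" "A \<subseteq> Poly_Mapping.keys p" for A
    using that
  proof (induction A rule: finite_induct)
    case empty
    then show ?case using const[of 0] by simp
  next
    case (insert m A)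
    have "Poly_Mapping.single k (Poly_Mapping.lookup p k) \<in> Pol n"
      if "k \<in> Poly_Mapping.keys p" for k
      using p that by (auto simp: Pol_def)
    then show ?case
      using insert p by (simp, intro add mono Pol_sum) (auto simp: Pol_def)
  qed
  have "p = (\<Sum>m\<in>Poly_Mapping.keys p. Poly_Mapping.single m (Poly_Mapping.lookup p m))"
    by (rule poly_mapping_eqI) (simp add: lookup_sum lookup_single when_def in_keys_iff)
  then show ?thesis using fin[of "Poly_Mapping.keys p"] by simp
qed

section \<open>Triangular derivations in coordinates\<close>

definition vfield :: "nat \<Rightarrow> (nat \<Rightarrow> 'a::field_char_0 mpoly) \<Rightarrow> 'a mpoly_map" where
  "vfield n a = (\<lambda>p. if p \<in> Pol n then \<Sum>j=1..n. a j * pdiff j p else 0)"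

lemma vfield_Var: "j \<in> {1..n} \<Longrightarrow> vfield n a (Var j) = a j"
  by (simp add: vfield_def Var_in_Pol_iff pdiff_Var sum.delta if_distrib[where f="(*) _"] cong: if_cong)

lemma vfield_in_tri: "(\<And>j. j \<in> {1..n} \<Longrightarrow> a j \<in> Pol (j - 1)) \<Longrightarrow> vfield n a \<in> tri n"
  unfolding tri_eq tri_ideal_iff vfield_def by blast

lemma tri_coeff: "D \<in> tri n \<Longrightarrow> j \<in> {1..n} \<Longrightarrow> D (Var j) \<in> Pol (j - 1)"
  unfolding tri_eq tri_ideal_iff vfield_def[symmetric] by (auto simp: vfield_Var)

lemma vfield_cong:
  assumes "\<And>j. j \<in> {1..n} \<Longrightarrow> a j = b j" shows "vfield n a = vfield n b"
  unfolding vfield_def using assms by (intro ext if_cong refl sum.cong) auto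

lemma tri_eq_vfield:
  assumes "D \<in> tri n" shows "D = vfield n (\<lambda>j. D (Var j))"
proof -
  obtain a where D: "D = vfield n a"
    using assms unfolding tri_eq tri_ideal_iff vfield_def[symmetric] by blast
  show ?thesis
    unfolding D by (rule vfield_cong) (simp add: vfield_Var)
qed

lemma tri_eqI:
  assumes "D \<in> tri n" "E \<in> tri n" "\<And>j. j \<in> {1..n} \<Longrightarrow> D (Var j) = E (Var j)"
  shows "D = E"
proof -
  have "D = vfield n (\<lambda>j. D (Var j))" by (rule tri_eq_vfield) fact
  also have "\<dots> = vfield n (\<lambda>j. E (Var j))" by (rule vfield_cong) fact
  also have "\<dots> = E" by (rule tri_eq_vfield[symmetric]) fact
  finally show ?thesis .
qed

lemma tri_outside: "D \<in> tri n \<Longrightarrow> p \<notin> Pol n \<Longrightarrow> D p = 0"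
  using tri_subset_Der DerD(5) by blast

text \<open>The coordinate description of the ideals. It turns every later statement about \<open>\<uu>\<^bsub>n,i\<^esub>\<close>
  into one about values at variables. The variables \<open>x\<^sub>j\<close> with \<open>j > n\<close> do no harm, because
  derivations are extended by \<open>0\<close> outside \<open>P\<^sub>n\<close>.\<close>
lemma tri_ideal_iff_Var:
  assumes "i \<ge> 1"
  shows "D \<in> tri_ideal n i \<longleftrightarrow> D \<in> tri n \<and> (\<forall>j\<in>{1..<i}. D (Var j) = 0)"
proof
  assume "D \<in> tri_ideal n i"
  then obtain a where a: "\<forall>j\<in>{i..n}. a j \<in> Pol (j - 1)"
    and D: "D = (\<lambda>p. if p \<in> Pol n then \<Sum>j=i..n. a j * pdiff j p else 0)"
    unfolding tri_ideal_iff by blast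
  define b where "b j = (if i \<le> j then a j else 0)" for j
  have sums: "(\<Sum>j=i..n. a j * pdiff j p) = (\<Sum>j=1..n. b j * pdiff j p)" for p
    using assms by (intro sum.mono_neutral_cong_left) (auto simp: b_def)
  have Db: "D = vfield n b" by (simp only: D vfield_def sums)
  have tri: "D \<in> tri n" unfolding Db using a by (intro vfield_in_tri) (auto simp: b_def)
  have "D (Var j) = 0" if j: "j \<in> {1..<i}" for j
  proof (cases "j \<le> n")
    case True
    then show ?thesis using j by (simp add: Db vfield_Var b_def)
  next
    case False
    then show ?thesis using tri tri_outside[of D n "Var j"] by (simp add: Var_in_Pol_iff)
  qed
  with tri show "D \<in> tri n \<and> (\<forall>j\<in>{1..<i}. D (Var j) = 0)" by blast
next
  assume D: "D \<in> tri n \<and> (\<forall>j\<in>{1..<i}. D (Var j) = 0)"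
  have sums: "(\<Sum>j=1..n. D (Var j) * pdiff j p) = (\<Sum>j=i..n. D (Var j) * pdiff j p)" for p
    using D assms by (intro sum.mono_neutral_cong_right) auto
  have "D = vfield n (\<lambda>j. D (Var j))" using D by (intro tri_eq_vfield) blast
  then have "D = (\<lambda>p. if p \<in> Pol n then \<Sum>j=i..n. D (Var j) * pdiff j p else 0)"
    by (simp only: vfield_def sums)
  then show "D \<in> tri_ideal n i"
    unfolding tri_ideal_iff using D assms tri_coeff[of D n]
    by (intro exI[of _ "\<lambda>j. D (Var j)"]) auto
qed

lemma tri_ideal_kills_Pol:
  assumes "D \<in> tri_ideal n i" "i \<ge> 1" "p \<in> Pol (i - 1)"
  shows "D p = 0"
proof -
  obtain a where "D = (\<lambda>p. if p \<in> Pol n then \<Sum>j=i..n. a j * pdiff j p else 0)"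
    using assms unfolding tri_ideal_iff by blast
  moreover have "pdiff j p = 0" if "j \<in> {i..n}" for j
    using assms that by (intro pdiff_eq_0[of _ "i - 1"]) auto
  ultimately show ?thesis by simp
qed

lemma tri_ideal_beyond: "n < i \<Longrightarrow> tri_ideal n i = {0}"
  by (auto simp: tri_ideal_def)

lemma partial_Var: "j \<in> {1..n} \<Longrightarrow> partial n i (Var j) = (if i = j then 1 else 0)"
  by (simp add: partial_def Var_in_Pol_iff pdiff_Var)

lemma partial_in_tri_ideal:
  assumes "i \<in> {1..n}" shows "partial n i \<in> tri_ideal n i"
proof -
  have eq: "partial n i = vfield n (\<lambda>j. if j = i then 1 else 0)"
    using assms by (simp add: partial_def vfield_def fun_eq_iff if_distrib[where f="\<lambda>x. x * _"] cong: if_cong)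
  have "partial n i \<in> tri n"
    unfolding eq by (intro vfield_in_tri) (simp add: Pol_def)
  then show ?thesis using assms
    by (simp add: tri_ideal_iff_Var partial_Var)
qed

lemma tri_ideal_antimono: "1 \<le> i \<Longrightarrow> i \<le> k \<Longrightarrow> tri_ideal n k \<subseteq> tri_ideal n i"
  by (auto simp: tri_ideal_iff_Var)

lemma tri_ideal_psubset:
  assumes "i \<in> {1..n}"
  shows "(tri_ideal n (i + 1) :: 'a::field_char_0 mpoly_map set) \<subset> tri_ideal n i"
proof -
  have "(partial n i :: 'a mpoly_map) \<notin> tri_ideal n (i + 1)"
    using assms partial_Var[of i n i, where ?'a='a]
    by (auto simp: tri_ideal_iff_Var intro!: bexI[of _ i])
  moreover have "(tri_ideal n (i + 1) :: 'a mpoly_map set) \<subseteq> tri_ideal n i"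
    using assms by (intro tri_ideal_antimono) auto
  ultimately show ?thesis
    using partial_in_tri_ideal[OF assms] by blast
qed

lemma tri_ideal_eq_0_iff:
  assumes "i \<ge> 1"
  shows "(tri_ideal n i :: 'a::field_char_0 mpoly_map set) = {0} \<longleftrightarrow> n < i"
proof
  assume eq: "(tri_ideal n i :: 'a mpoly_map set) = {0}"
  show "n < i"
  proof (rule ccontr)
    assume "\<not> n < i"
    then have "(partial n i :: 'a mpoly_map) = 0"
      using eq assms partial_in_tri_ideal[of i n] by fastforce
    then show False
      using partial_Var[of i n i, where ?'a='a] assms \<open>\<not> n < i\<close> by simp
  qed
qed (rule tri_ideal_beyond)

section \<open>The ideals, the derived series and the upper central series\<close>

lemma tri_ideal_subspace:
  assumes "i \<ge> 1" shows "dvs.subspace (tri_ideal n i)"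
proof (rule dvs.subspaceI)
  note mem = tri_ideal_iff_Var[OF assms]
  show "0 \<in> tri_ideal n i"
    by (simp add: mem dvs.subspace_0[OF tri_subspace])
  show "D + E \<in> tri_ideal n i" if "D \<in> tri_ideal n i" "E \<in> tri_ideal n i"
    for D E :: "'a mpoly_map"
    using that by (simp add: mem dvs.subspace_add[OF tri_subspace])
  show "dscale c D \<in> tri_ideal n i" if "D \<in> tri_ideal n i" for c and D :: "'a mpoly_map"
    using that dvs.subspace_scale[OF tri_subspace, of D n c] by (simp add: mem dscale_def pscale_simps)
qed

text \<open>A triangular \<open>D\<close> maps \<open>x\<^sub>j\<close> into \<open>P\<^bsub>j-1\<^esub>\<close>; for \<open>j < i\<close> this is killed by \<open>E\<close>, and so is
  \<open>x\<^sub>j\<close>.\<close>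
lemma commutator_in_tri_ideal:
  assumes i: "i \<ge> 1" and D: "D \<in> tri n" and E: "E \<in> tri_ideal n i"
  shows "commutator D E \<in> tri_ideal n i"
proof -
  have E': "E \<in> tri n" "\<And>j. j \<in> {1..<i} \<Longrightarrow> E (Var j) = 0"
    using E i by (auto simp: tri_ideal_iff_Var)
  have "commutator D E (Var j) = 0" if j: "j \<in> {1..<i}" for j
  proof (cases "j \<le> n")
    case True
    then have "D (Var j) \<in> Pol (i - 1)"
      using tri_coeff[OF D, of j] j by (auto intro: Pol_mono[of "j - 1"])
    then have "E (D (Var j)) = 0" by (rule tri_ideal_kills_Pol[OF E i])
    then show ?thesis
      using D tri_subset_Der[of n] DerD(6)[of D n] E'(2) j by (auto simp: commutator_apply)
  next
    case False
    then show ?thesis using tri_commutator[OF D E'(1)]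
      by (intro tri_outside[of _ n]) (simp_all add: Var_in_Pol_iff)
  qed
  then show ?thesis
    using tri_commutator[OF D E'(1)] i by (simp add: tri_ideal_iff_Var)
qed

lemma lie_ideal_tri_ideal:
  assumes "i \<ge> 1" shows "lie_ideal dscale commutator (tri n) (tri_ideal n i)"
  unfolding lie_ideal_def
  using tri_ideal_subspace[OF assms] commutator_in_tri_ideal[OF assms] tri_ideal_iff_Var[OF assms]
  by blast

text \<open>The only new point is the value at \<open>x\<^sub>i\<close>: both \<open>D x\<^sub>i\<close> and \<open>E x\<^sub>i\<close> lie in \<open>P\<^bsub>i-1\<^esub>\<close>, which
  \<open>D\<close> and \<open>E\<close> kill.\<close>
lemma commutator_in_tri_ideal_Suc:
  assumes i: "i \<ge> 1" and D: "D \<in> tri_ideal n i" and E: "E \<in> tri_ideal n i"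
  shows "commutator D E \<in> tri_ideal n (Suc i)"
proof -
  have tri: "D \<in> tri n" "E \<in> tri n"
    using D E i by (auto simp: tri_ideal_iff_Var)
  note DE = commutator_in_tri_ideal[OF i tri(1) E]
  have "commutator D E (Var i) = 0"
  proof (cases "i \<le> n")
    case True
    then have "D (Var i) \<in> Pol (i - 1)" "E (Var i) \<in> Pol (i - 1)"
      using tri_coeff[OF tri(1), of i] tri_coeff[OF tri(2), of i] i by auto
    then show ?thesis
      using tri_ideal_kills_Pol[OF D i] tri_ideal_kills_Pol[OF E i] by (simp add: commutator_apply)
  next
    case False
    then show ?thesis using tri_commutator[OF tri]
      by (intro tri_outside[of _ n]) (simp_all add: Var_in_Pol_iff)
  qed
  then show ?thesis
    using DE i by (auto simp: tri_ideal_iff_Var less_Suc_eq)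
qed

text \<open>Since \<open>\<partial>\<^sub>i x\<^sub>j\<close> is constant, it is killed by \<open>E\<close>, and the \<open>j\<close>-th coordinate of \<open>[\<partial>\<^sub>i, E]\<close> is
  \<open>\<partial>\<^sub>i (E x\<^sub>j)\<close>. So a preimage of \<open>D\<close> is obtained by integrating its coordinates with respect to
  \<open>x\<^sub>i\<close>; for \<open>j > i\<close> the integral stays in \<open>P\<^bsub>j-1\<^esub>\<close>, and the other coordinates vanish.\<close>
lemma commutator_partial_surj:
  assumes "i \<in> {1..n}" "D \<in> tri_ideal n (Suc i)"
  shows "\<exists>E \<in> tri_ideal n (Suc i). commutator (partial n i) E = D"
proof -
  have D: "D \<in> tri n" "\<And>j. j \<in> {1..i} \<Longrightarrow> D (Var j) = 0"
    using assms by (auto simp: tri_ideal_iff_Var)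
  define E where "E = vfield n (\<lambda>j. antidiff i (D (Var j)))"
  have "antidiff i (D (Var j)) \<in> Pol (j - 1)" if j: "j \<in> {1..n}" for j
  proof (cases "j \<le> i")
    case True
    then show ?thesis using D(2) j by (simp add: antidiff_def)
  next
    case False
    then show ?thesis using assms tri_coeff[OF D(1) j] by (intro Pol_antidiff) auto
  qed
  then have tri: "E \<in> tri n" unfolding E_def by (rule vfield_in_tri)
  have p: "partial n i \<in> tri n"
    using partial_in_tri_ideal[OF assms(1)] assms by (auto simp: tri_ideal_iff_Var)
  have Pn: "E (Var j) \<in> Pol n" if "j \<in> {1..n}" for j
    using tri_coeff[OF tri that] that by (auto intro: Pol_mono[of "j - 1"])
  have "E 1 = 0"
    by (rule tri_ideal_kills_Pol[of _ n 1]) (use tri in \<open>auto simp: tri_eq Pol_def\<close>)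
  moreover have "E 0 = 0" using tri tri_subset_Der DerD(6) by blast
  ultimately have "E (partial n i (Var j)) = 0" if "j \<in> {1..n}" for j
    using that by (simp add: partial_Var)
  then have "commutator (partial n i) E (Var j) = D (Var j)" if "j \<in> {1..n}" for j
    using that Pn by (simp add: commutator_apply partial_def)
      (simp add: E_def vfield_Var pdiff_antidiff)
  then have "commutator (partial n i) E = D"
    by (intro tri_eqI[of _ n] tri_commutator p tri D)
  moreover have "E \<in> tri_ideal n (Suc i)"
    using tri D(2) assms by (auto simp: tri_ideal_iff_Var E_def vfield_Var antidiff_def)
  ultimately show ?thesis by blast
qed

text \<open>In all brackets of ideals below, every element of the result is a single commutator, so that
  the linear span adds nothing.\<close>
lemma bracket_span_eqI:
  assumes "dvs.subspace W"
    and "\<And>D E. D \<in> U \<Longrightarrow> E \<in> V \<Longrightarrow> commutator D E \<in> W"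
    and "\<And>F. F \<in> W \<Longrightarrow> \<exists>D\<in>U. \<exists>E\<in>V. commutator D E = F"
  shows "bracket_span dscale commutator U V = W"
  unfolding bracket_span_def
proof
  show "dvs.span {commutator u v |u v. u \<in> U \<and> v \<in> V} \<subseteq> W"
    using assms(1,2) by (intro dvs.span_minimal) auto
  show "W \<subseteq> dvs.span {commutator u v |u v. u \<in> U \<and> v \<in> V}"
    using assms(3) by (fastforce intro: dvs.span_base)
qed

lemma bracket_span_tri_ideal_self:
  assumes "i \<ge> 1"
  shows "bracket_span dscale commutator (tri_ideal n i) (tri_ideal n i) = tri_ideal n (Suc i)"
proof (rule bracket_span_eqI)
  fix F :: "'a mpoly_map" assume F: "F \<in> tri_ideal n (Suc i)"
  show "\<exists>D\<in>tri_ideal n i. \<exists>E\<in>tri_ideal n i. commutator D E = F"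
  proof (cases "i \<le> n")
    case True
    with F assms obtain E where "E \<in> tri_ideal n (Suc i)" "commutator (partial n i) E = F"
      using commutator_partial_surj[of i n F] by auto
    then show ?thesis
      using True assms partial_in_tri_ideal[of i n] tri_ideal_antimono[of i "Suc i" n] by auto
  next
    case False
    then show ?thesis
      using F by (auto simp: tri_ideal_beyond commutator_def fun_eq_iff)
  qed
qed (use assms in \<open>auto intro: tri_ideal_subspace commutator_in_tri_ideal_Suc\<close>)

lemma bracket_span_tri_tri_ideal_2:
  assumes "n \<ge> 1"
  shows "bracket_span dscale commutator (tri n) (tri_ideal n 2) = tri_ideal n 2"
proof (rule bracket_span_eqI)
  fix F :: "'a mpoly_map" assume "F \<in> tri_ideal n 2"
  then show "\<exists>D\<in>tri n. \<exists>E\<in>tri_ideal n 2. commutator D E = F"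
    using commutator_partial_surj[of 1 n F] partial_in_tri_ideal[of 1 n] assms
    by (auto simp: tri_eq numeral_2_eq_2)
qed (auto intro: tri_ideal_subspace commutator_in_tri_ideal)

lemma derived_series_tri: "derived_series dscale commutator (tri n) i = tri_ideal n (Suc i)"
  by (induction i) (simp_all add: tri_eq bracket_span_tri_ideal_self)

lemma upper_central_series_tri:
  assumes "n \<ge> 1"
  shows "upper_central_series dscale commutator (tri n) (Suc i) = tri_ideal n 2"
proof (induction i)
  case 0
  then show ?case
    using bracket_span_tri_ideal_self[of 1 n] by (simp add: tri_eq numeral_2_eq_2)
qed (use assms in \<open>simp add: bracket_span_tri_tri_ideal_2\<close>)

section \<open>Local nilpotence\<close>

lemma Der_funpow:
  assumes D: "D \<in> Der n"
  shows "p \<in> Pol n \<Longrightarrow> (D ^^ k) p \<in> Pol n"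
    and "p \<in> Pol n \<Longrightarrow> q \<in> Pol n \<Longrightarrow> (D ^^ k) (p + q) = (D ^^ k) p + (D ^^ k) q"
    and "p \<in> Pol n \<Longrightarrow> q \<in> Pol n \<Longrightarrow> (D ^^ k) (p - q) = (D ^^ k) p - (D ^^ k) q"
    and "(D ^^ k) 0 = 0"
proof -
  show *: "p \<in> Pol n \<Longrightarrow> (D ^^ k) p \<in> Pol n" for p k
    by (induction k) (simp_all add: DerD[OF D])
  show "p \<in> Pol n \<Longrightarrow> q \<in> Pol n \<Longrightarrow> (D ^^ k) (p + q) = (D ^^ k) p + (D ^^ k) q"
    by (induction k) (simp_all add: DerD[OF D] *)
  show "p \<in> Pol n \<Longrightarrow> q \<in> Pol n \<Longrightarrow> (D ^^ k) (p - q) = (D ^^ k) p - (D ^^ k) q"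
    by (induction k) (simp_all add: DerD[OF D] *)
  show "(D ^^ k) 0 = 0" by (induction k) (simp_all add: DerD[OF D])
qed

lemma Der_funpow_eq_0_mono:
  assumes "D \<in> Der n" "(D ^^ k) p = 0" "k \<le> l"
  shows "(D ^^ l) p = 0"
proof -
  have "(D ^^ l) p = (D ^^ (l - k)) ((D ^^ k) p)"
    using assms(3) by (metis comp_apply funpow_add le_add_diff_inverse2)
  then show ?thesis using assms by (simp add: Der_funpow)
qed

text \<open>By \<open>D (p * q) = D p * q + p * D q\<close>, one application of \<open>D\<close> lowers the sum of the two
  nilpotency bounds by one in each summand; this avoids the binomial expansion of
  \<open>D\<^sup>k (p * q)\<close>.\<close>
lemma Der_funpow_mult_eq_0:
  assumes D: "D \<in> Der n"
  shows "p \<in> Pol n \<Longrightarrow> q \<in> Pol n \<Longrightarrow> (D ^^ k) p = 0 \<Longrightarrow> (D ^^ l) q = 0 \<Longrightarrow>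
    (D ^^ (k + l)) (p * q) = 0"
proof (induction "k + l" arbitrary: k l p q)
  case (Suc N)
  show ?case
  proof (cases "k = 0 \<or> l = 0")
    case True
    then show ?thesis using Suc.prems by (auto simp: Der_funpow[OF D])
  next
    case False
    then obtain k' l' where kl: "k = Suc k'" "l = Suc l'" by (metis not0_implies_Suc)
    note mem = Suc.prems(1,2) DerD(1)[OF D] Pol_mult
    have "(D ^^ N) (D p * q) = 0" "(D ^^ N) (p * D q) = 0"
      using Suc.hyps(1)[of k' l "D p" q] Suc.hyps(1)[of k l' p "D q"] Suc.prems Suc.hyps(2) kl
      by (auto simp: DerD(1)[OF D] funpow_Suc_right simp del: funpow.simps)
    moreover have "(D ^^ (k + l)) (p * q) = (D ^^ N) (D p * q + p * D q)"
      unfolding Suc.hyps(2)[symmetric]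
      by (simp add: funpow_Suc_right DerD(4)[OF D] mem del: funpow.simps)
    ultimately show ?thesis by (simp add: Der_funpow(2)[OF D] mem)
  qed
qed simp

text \<open>Induction on \<open>j\<close> proves the claim on \<open>P\<^sub>j\<close>: the polynomials killed by a power of \<open>D\<close> form a
  subalgebra, so only the generators \<open>x\<^sub>i\<close> with \<open>i \<le> j\<close> matter, and \<open>D x\<^sub>i\<close> lies in
  \<open>P\<^bsub>i-1\<^esub>\<close>.\<close>
lemma tri_nilpotent_at:
  assumes D: "D \<in> tri n"
  shows "p \<in> Pol n \<Longrightarrow> \<exists>k. (D ^^ k) p = 0"
proof -
  have Der: "D \<in> Der n" using D tri_subset_Der by blast
  have "j \<le> n \<Longrightarrow> p \<in> Pol j \<Longrightarrow> \<exists>k. (D ^^ k) p = 0" for j p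
  proof (induction j arbitrary: p rule: less_induct)
    case (less j)
    show ?case using less.prems(2)
    proof (rule Pol_generated_by_Var)
      show "\<exists>k. (D ^^ k) (Poly_Mapping.single 0 c) = 0" for c
        using tri_ideal_kills_Pol[of D n 1] D
        by (intro exI[of _ 1]) (simp add: tri_eq Pol_single0)
    next
      fix i assume i: "i \<in> {1..j}"
      then have "D (Var i) \<in> Pol (i - 1)" using D less.prems by (intro tri_coeff[of _ n]) auto
      then obtain k where "(D ^^ k) (D (Var i)) = 0"
        using less.IH[of "i - 1"] i less.prems by fastforce
      then have "(D ^^ Suc k) (Var i) = 0" by (simp add: funpow_Suc_right del: funpow.simps)
      then show "\<exists>k. (D ^^ k) (Var i) = 0" by blast
    next
      fix p q :: "'a mpoly" assume pq: "p \<in> Pol j" "q \<in> Pol j"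
        and "\<exists>k. (D ^^ k) p = 0" "\<exists>k. (D ^^ k) q = 0"
      then obtain k l where kl: "(D ^^ k) p = 0" "(D ^^ l) q = 0" by blast
      have mem: "p \<in> Pol n" "q \<in> Pol n" using pq less.prems Pol_mono by blast+
      show "\<exists>k. (D ^^ k) (p * q) = 0" using Der_funpow_mult_eq_0[OF Der mem kl] by blast
      have "(D ^^ max k l) (p + q) = 0"
        using kl mem Der_funpow_eq_0_mono[OF Der, of _ _ "max k l"]
        by (simp add: Der_funpow[OF Der])
      then show "\<exists>k. (D ^^ k) (p + q) = 0" by blast
    qed
  qed
  then show "p \<in> Pol n \<Longrightarrow> \<exists>k. (D ^^ k) p = 0" by blast
qed

lemma tri_locally_nilpotent:
  assumes D: "D \<in> tri n"
  shows "locally_nilpotent_on pscale (Pol n) D"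
proof -
  have Der: "D \<in> Der n" using D tri_subset_Der by blast
  have "\<exists>N. \<forall>i\<ge>N. (D ^^ i) p = 0" if "p \<in> Pol n" for p
    using tri_nilpotent_at[OF D that] Der_funpow_eq_0_mono[OF Der] by blast
  moreover have "linear_map_on pscale pscale (Pol n) (Pol n) D"
    using Der by (simp add: Der_def)
  ultimately show ?thesis by (simp add: locally_nilpotent_on_def)
qed

lemma tri_ad_funpow:
  assumes "D \<in> tri n" "E \<in> tri n"
  shows "(commutator D ^^ k) E \<in> tri n"
  by (induction k) (simp_all add: assms tri_commutator)

text \<open>The analogue of the product rule estimate for the pairing \<open>(E, p) \<mapsto> E p\<close>. The identity
  \<open>D\<^sup>c ([D,F] p) = D\<^bsup>c+1\<^esup> (F p) - D\<^sup>c (F (D p))\<close>, where \<open>F\<close> is \<open>(ad D)\<^sup>k E\<close>, trades one application of \<open>ad D\<close>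
  either for one more power of \<open>D\<close> on the outside or for a lower nilpotency bound \<open>a\<close> of the argument. The
  claim is stated for all \<open>c\<close> and \<open>p\<close> because both change in the induction; it is used for
  \<open>c = 0\<close>.\<close>
lemma ad_funpow_apply_eq_0:
  assumes D: "D \<in> tri n" and E: "E \<in> tri n"
  shows "p \<in> Pol n \<Longrightarrow> (D ^^ a) p = 0 \<Longrightarrow> (\<And>i. (D ^^ b) (E ((D ^^ i) p)) = 0) \<Longrightarrow>
    a + b \<le> c + k \<Longrightarrow> (D ^^ c) ((commutator D ^^ k) E p) = 0"
proof (induction k arbitrary: a c p)
  case 0
  have "D \<in> Der n" using D tri_subset_Der by blast
  then show ?case using 0(3)[of 0] 0(4) Der_funpow_eq_0_mono[of D n b "E p" c] by simp
next
  case (Suc k)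
  have Der: "D \<in> Der n" using D tri_subset_Der by blast
  define F where "F = (commutator D ^^ k) E"
  have F: "F \<in> tri n" "F \<in> Der n"
    using tri_ad_funpow[OF D E] tri_subset_Der by (auto simp: F_def)
  have "(D ^^ c) (commutator D F p) = (D ^^ Suc c) (F p) - (D ^^ c) (F (D p))"
    using Suc.prems(1) by (simp add: commutator_apply Der_funpow[OF Der] DerD(1)[OF Der]
      DerD(1)[OF F(2)] funpow_Suc_right del: funpow.simps)
  also have "(D ^^ Suc c) (F p) = 0"
    unfolding F_def using Suc.prems(4) by (intro Suc.IH[OF Suc.prems(1-3)]) simp
  also have "(D ^^ c) (F (D p)) = 0"
  proof (cases a)
    case 0
    then show ?thesis
      using Suc.prems(2) by (simp add: DerD(6)[OF Der] DerD(6)[OF F(2)] Der_funpow(4)[OF Der])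
  next
    case (Suc a')
    have "(D ^^ b) (E ((D ^^ i) (D p))) = 0" for i
      using Suc.prems(3)[of "Suc i"] by (simp add: funpow_Suc_right del: funpow.simps)
    moreover have "(D ^^ a') (D p) = 0"
      using Suc.prems(2) Suc by (simp add: funpow_Suc_right del: funpow.simps)
    moreover have "a' + b \<le> c + k" using Suc.prems(4) Suc by simp
    ultimately show ?thesis
      unfolding F_def using DerD(1)[OF Der Suc.prems(1)] by (intro Suc.IH)
  qed
  finally show ?case by (simp add: F_def)
qed

lemma tri_ad_nilpotent_at:
  assumes D: "D \<in> tri n" and E: "E \<in> tri n"
  shows "\<exists>N. \<forall>k\<ge>N. (commutator D ^^ k) E = 0"
proof -
  have Der: "D \<in> Der n" "E \<in> Der n" using D E tri_subset_Der by blast+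
  have "\<exists>N. \<forall>k\<ge>N. (commutator D ^^ k) E p = 0" if p: "p \<in> Pol n" for p
  proof -
    obtain a where a: "(D ^^ a) p = 0" using tri_nilpotent_at[OF D p] by blast
    have "\<exists>b. (D ^^ b) (E ((D ^^ i) p)) = 0" for i
      using p by (intro tri_nilpotent_at[OF D] DerD(1)[OF Der(2)] Der_funpow(1)[OF Der(1)])
    then have "\<forall>i. \<exists>b. (D ^^ b) (E ((D ^^ i) p)) = 0" by blast
    from choice[OF this] obtain b where b: "\<And>i. (D ^^ b i) (E ((D ^^ i) p)) = 0" by blast
    \<comment> \<open>Only \<open>i \<le> a\<close> matters, since \<open>D\<^sup>i p = 0\<close> beyond, so one bound serves for all \<open>i\<close>.\<close>
    define B where "B = Max (b ` {..a})"
    have "(D ^^ B) (E ((D ^^ i) p)) = 0" for i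
    proof (cases "i \<le> a")
      case True
      then show ?thesis
        using Der_funpow_eq_0_mono[OF Der(1) b] by (auto simp: B_def)
    next
      case False
      then show ?thesis using Der_funpow_eq_0_mono[OF Der(1) a, of i]
        by (simp add: DerD(6)[OF Der(2)] Der_funpow(4)[OF Der(1)])
    qed
    then have "(commutator D ^^ k) E p = 0" if "a + B \<le> k" for k
      using ad_funpow_apply_eq_0[OF D E p a, of B 0 k] that by simp
    then show ?thesis by blast
  qed
  then have "\<forall>j\<in>{1..n}. \<exists>N. \<forall>k\<ge>N. (commutator D ^^ k) E (Var j) = 0"
    by (simp add: Var_in_Pol_iff)
  from bchoice[OF this]
  obtain N where N: "\<And>j k. j \<in> {1..n} \<Longrightarrow> k \<ge> N j \<Longrightarrow> (commutator D ^^ k) E (Var j) = 0"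
    by blast
  have "(commutator D ^^ k) E = 0" if k: "k \<ge> Max (N ` {1..n})" for k
  proof (rule tri_eqI)
    fix j assume j: "j \<in> {1..n}"
    then have "N j \<le> Max (N ` {1..n})" by simp
    then show "(commutator D ^^ k) E (Var j) = 0 (Var j)" using N j k by simp
  qed (simp_all add: tri_ad_funpow D E dvs.subspace_0[OF tri_subspace])
  then show ?thesis by blast
qed

lemma (in lie_algebra) inner_derivation:
  assumes x: "x \<in> G" shows "lie_derivation scale br G (br x)"
proof -
  have anti: "br v u = - br u v" if u: "u \<in> G" and v: "v \<in> G" for u v
  proof -
    have "0 = br (u + v) (u + v)"
      using subspace_add[OF subspace_carrier u v] by (simp add: br_self)
    also have "\<dots> = br u v + br v u"
      using u v subspace_add[OF subspace_carrier u v]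
      by (simp add: br_add_left br_add_right br_self[OF u] br_self[OF v])
    finally show ?thesis by (metis minus_unique)
  qed
  have "br x (br y z) = br (br x y) z + br y (br x z)" if y: "y \<in> G" and z: "z \<in> G" for y z
  proof -
    have "br y (br z x) = br y (scale (- 1) (br x z))"
      using anti[OF x z] by simp
    also have "\<dots> = - br y (br x z)"
      using br_scale_right[OF y br_closed[OF x z], of "- 1"] by simp
    finally have "br x (br y z) - br y (br x z) - br (br x y) z = 0"
      using jacobi[OF x y z] anti[OF br_closed[OF x y] z] by simp
    then show ?thesis by (simp add: diff_diff_add add.commute)
  qed
  then show ?thesis
    by (simp add: lie_derivation_def linear_map_on_def x br_closed br_add_right br_scale_right)
qed

section \<open>The centre\<close>

text \<open>Evaluating \<open>[z, x\<^sub>i \<partial>\<^bsub>i+1\<^esub>] = 0\<close> at \<open>x\<^bsub>i+1\<^esub>\<close> gives \<open>z x\<^sub>i = 0\<close> for \<open>i < n\<close>, and evaluating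
  \<open>[z, \<partial>\<^sub>i] = 0\<close> at \<open>x\<^sub>n\<close> gives \<open>\<partial>\<^sub>i (z x\<^sub>n) = 0\<close> for all \<open>i\<close>. Conversely \<open>\<partial>\<^sub>n\<close> is central because no
  coordinate of a triangular derivation involves \<open>x\<^sub>n\<close>, and the coordinates of \<open>\<partial>\<^sub>n\<close> are constants.\<close>
lemma lie_centre_tri:
  assumes n: "n \<ge> 1"
  shows "lie_centre commutator (tri n) = {dscale c (partial n n) | c. True}"
proof (intro set_eqI iffI)
  fix z :: "'a mpoly_map" assume "z \<in> lie_centre commutator (tri n)"
  then have z: "z \<in> tri n" and central: "\<And>E. E \<in> tri n \<Longrightarrow> commutator z E = 0"
    by (auto simp: lie_centre_def)
  have part: "(partial n i :: 'a mpoly_map) \<in> tri n" if "i \<in> {1..n}" for i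
    using partial_in_tri_ideal[OF that] that by (auto simp: tri_ideal_iff_Var)
  have z0: "z 0 = 0" "z 1 = 0"
    using tri_ideal_kills_Pol[of z n 1] z by (simp_all add: tri_eq Pol_def)
  have low: "z (Var i) = 0" if i: "i \<in> {1..<n}" for i
  proof -
    define E :: "'a mpoly_map" where "E = vfield n (\<lambda>j. if j = Suc i then Var i else 0)"
    have "E \<in> tri n" unfolding E_def using i by (intro vfield_in_tri) (auto simp: Var_in_Pol_iff)
    then have "commutator z E (Var (Suc i)) = 0" and E: "E \<in> tri_ideal n (Suc i)"
      using central i by (auto simp: tri_ideal_iff_Var E_def vfield_Var)
    moreover have "E (z (Var (Suc i))) = 0"
      using tri_coeff[OF z, of "Suc i"] i by (intro tri_ideal_kills_Pol[OF E]) auto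
    moreover have "E (Var (Suc i)) = Var i" using i by (simp add: E_def vfield_Var)
    ultimately show ?thesis by (simp add: commutator_apply)
  qed
  have zn: "z (Var n) \<in> Pol n" using tri_coeff[OF z, of n] n by (auto intro: Pol_mono[of "n - 1"])
  have "pdiff i (z (Var n)) = 0" if i: "i \<in> {1..n}" for i
  proof -
    have "commutator z (partial n i) (Var n) = 0" using central[OF part[OF i]] by simp
    moreover have "z (partial n i (Var n)) = 0" using n z0 by (simp add: partial_Var)
    ultimately show ?thesis using zn by (simp add: commutator_apply partial_def)
  qed
  then obtain c where c: "z (Var n) = pscale c 1"
    using constant_if_pdiff_eq_0[OF zn] by blast
  have "z = dscale c (partial n n)"
  proof (rule tri_eqI[OF z])
    show "dscale c (partial n n) \<in> tri n"
      using part n by (intro dvs.subspace_scale[OF tri_subspace]) auto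
    show "z (Var j) = dscale c (partial n n) (Var j)" if "j \<in> {1..n}" for j
      using that low[of j] c by (cases "j = n") (auto simp: dscale_def partial_Var pscale_simps)
  qed
  then show "z \<in> {dscale c (partial n n) | c. True}" by blast
next
  fix z :: "'a mpoly_map" assume "z \<in> {dscale c (partial n n) | c. True}"
  then obtain c where zc: "z = dscale c (partial n n)" by blast
  have z: "z \<in> tri_ideal n n"
    unfolding zc using n by (intro dvs.subspace_scale[OF tri_ideal_subspace] partial_in_tri_ideal) auto
  then have tri: "z \<in> tri n" using n by (simp add: tri_ideal_iff_Var)
  have "commutator z E = 0" if E: "E \<in> tri n" for E
  proof (rule tri_eqI[of _ n])
    fix j assume j: "j \<in> {1..n}"
    have "z (E (Var j)) = 0"
      using tri_coeff[OF E j] j n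
      by (intro tri_ideal_kills_Pol[OF z]) (auto intro: Pol_mono[of "j - 1"])
    moreover have "z (Var j) \<in> Pol 0"
      unfolding zc using j by (simp add: dscale_def partial_Var pscale_def Pol_def)
    then have "E (z (Var j)) = 0"
      using tri_ideal_kills_Pol[of E n 1] E by (simp add: tri_eq)
    ultimately show "commutator z E (Var j) = 0 (Var j)" by (simp add: commutator_apply)
  qed (simp_all add: tri_commutator tri E dvs.subspace_0[OF tri_subspace])
  then show "z \<in> lie_centre commutator (tri n)" using tri by (simp add: lie_centre_def)
qed

section \<open>Invariance of the derived series\<close>

lemma (in lie_algebra) derived_series_subset: "derived_series scale br G i \<subseteq> G"
proof (induction i)
  case (Suc i)
  then have "{br u v |u v. u \<in> derived_series scale br G i \<and> v \<in> derived_series scale br G i} \<subseteq> G"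
    using br_closed by blast
  then show ?case
    unfolding derived_series.simps bracket_span_def by (rule span_minimal[OF _ subspace_carrier])
qed simp

text \<open>A surjective homomorphism maps the span of a subset of \<open>G\<close> onto the span of its image, and
  brackets to brackets. The linearity of \<open>\<phi>\<close> is known on \<open>G\<close> only, so membership in \<open>G\<close> has to be
  carried along with every span.\<close>
lemma derived_series_image:
  assumes "lie_algebra s b G" "lie_algebra t c H"
    and lin: "linear_map_on s t G H \<phi>" and surj: "\<phi> ` G = H"
    and hom: "\<And>x y. x \<in> G \<Longrightarrow> y \<in> G \<Longrightarrow> \<phi> (b x y) = c (\<phi> x) (\<phi> y)"
  shows "derived_series t c H i = \<phi> ` derived_series s b G i"
proof -
  interpret G: lie_algebra s b G by fact
  interpret H: lie_algebra t c H by fact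
  have add: "\<And>x y. x \<in> G \<Longrightarrow> y \<in> G \<Longrightarrow> \<phi> (x + y) = \<phi> x + \<phi> y"
    and scale: "\<And>k x. x \<in> G \<Longrightarrow> \<phi> (s k x) = t k (\<phi> x)"
    using lin by (auto simp: linear_map_on_def)
  have zero: "\<phi> 0 = 0" using add[of 0 0] G.subspace_0[OF G.subspace_carrier] by simp
  have span: "\<phi> ` G.span S = H.span (\<phi> ` S)" if S: "S \<subseteq> G" for S
  proof
    have "x \<in> G \<and> \<phi> x \<in> H.span (\<phi> ` S)" if "x \<in> G.span S" for x
      using that
    proof (induction rule: G.span_induct_alt)
      case base
      then show ?case using zero G.subspace_0[OF G.subspace_carrier] by (simp add: H.span_zero)
    next
      case (step k x y)
      then have x: "x \<in> G" "s k x \<in> G" "\<phi> x \<in> H.span (\<phi> ` S)" and y: "y \<in> G"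
        using S G.subspace_scale[OF G.subspace_carrier] by (auto intro: H.span_base)
      show ?case
        using step x y
        by (simp add: add scale G.subspace_add[OF G.subspace_carrier] H.span_add H.span_scale)
    qed
    then show "\<phi> ` G.span S \<subseteq> H.span (\<phi> ` S)" by blast
    have sub: "G.span S \<subseteq> G" using S G.subspace_carrier by (rule G.span_minimal)
    show "H.span (\<phi> ` S) \<subseteq> \<phi> ` G.span S"
    proof (rule H.span_minimal)
      show "\<phi> ` S \<subseteq> \<phi> ` G.span S" by (intro image_mono G.span_superset)
      show "H.subspace (\<phi> ` G.span S)"
      proof (rule H.subspaceI)
        show "0 \<in> \<phi> ` G.span S" using zero by (metis G.span_zero imageI)
      next
        fix x y assume "x \<in> \<phi> ` G.span S" "y \<in> \<phi> ` G.span S"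
        then show "x + y \<in> \<phi> ` G.span S"
          using sub by (auto simp: subset_iff add[symmetric] intro!: imageI G.span_add)
      next
        fix k x assume "x \<in> \<phi> ` G.span S"
        then show "t k x \<in> \<phi> ` G.span S"
          using sub by (auto simp: subset_iff scale[symmetric] intro!: imageI G.span_scale)
      qed
    qed
  qed
  show ?thesis
  proof (induction i)
    case 0
    then show ?case using surj by simp
  next
    case (Suc i)
    define A where "A = derived_series s b G i"
    have A: "A \<subseteq> G" unfolding A_def by (rule G.derived_series_subset)
    have "{c u v |u v. u \<in> \<phi> ` A \<and> v \<in> \<phi> ` A} = \<phi> ` {b u v |u v. u \<in> A \<and> v \<in> A}"
    proof (intro subset_antisym subsetI)
      have *: "c (\<phi> u) (\<phi> v) = \<phi> (b u v)" if "u \<in> A" "v \<in> A" for u v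
        using hom[of u v] A that by (simp add: subset_iff)
      show "x \<in> \<phi> ` {b u v |u v. u \<in> A \<and> v \<in> A}"
        if "x \<in> {c u v |u v. u \<in> \<phi> ` A \<and> v \<in> \<phi> ` A}" for x
        using that * by auto
      show "x \<in> {c u v |u v. u \<in> \<phi> ` A \<and> v \<in> \<phi> ` A}"
        if "x \<in> \<phi> ` {b u v |u v. u \<in> A \<and> v \<in> A}" for x
        using that *[symmetric] by blast
    qed
    moreover have "{b u v |u v. u \<in> A \<and> v \<in> A} \<subseteq> G" using A G.br_closed by auto
    ultimately show ?case
      using Suc by (simp add: bracket_span_def span flip: A_def)
  qed
qed

text \<open>The \<open>i\<close>-th term of the derived series of \<open>\<uu>\<^sub>n\<close> is zero exactly for \<open>i \<ge> n\<close>, and an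
  isomorphism preserves whether a term is zero.\<close>
lemma tri_not_isomorphic:
  assumes "m \<noteq> n"
  shows "\<not> lie_isomorphic dscale commutator (tri m :: 'a::field_char_0 mpoly_map set)
    dscale commutator (tri n :: 'a mpoly_map set)"
proof
  assume "lie_isomorphic dscale commutator (tri m :: 'a mpoly_map set)
    dscale commutator (tri n :: 'a mpoly_map set)"
  then obtain \<phi> :: "'a mpoly_map \<Rightarrow> 'a mpoly_map" where
    lin: "linear_map_on dscale dscale (tri m) (tri n) \<phi>" and bij: "bij_betw \<phi> (tri m) (tri n)"
    and hom: "\<forall>x\<in>tri m. \<forall>y\<in>tri m. \<phi> (commutator x y) = commutator (\<phi> x) (\<phi> y)"
    unfolding lie_isomorphic_def by blast
  have image: "tri_ideal n (Suc i) = \<phi> ` tri_ideal m (Suc i)" for i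
    using derived_series_image[OF lie_algebra_tri lie_algebra_tri lin, of i] bij hom
    by (simp add: derived_series_tri bij_betw_def)
  have zero: "\<phi> 0 = 0" "0 \<in> tri m"
    using lin dvs.subspace_0[OF tri_subspace]
    by (auto simp: linear_map_on_def dest!: bspec[of _ _ 0])
  have "n < Suc i \<longleftrightarrow> m < Suc i" for i
  proof -
    have "(tri_ideal m (Suc i) :: 'a mpoly_map set) \<subseteq> tri m" by (auto simp: tri_ideal_iff_Var)
    then have "\<phi> ` tri_ideal m (Suc i) = \<phi> ` {0} \<longleftrightarrow>
        (tri_ideal m (Suc i) :: 'a mpoly_map set) = {0}"
      using zero by (intro inj_on_image_eq_iff[OF bij_betw_imp_inj_on[OF bij]]) simp_all
    then show ?thesis
      using image[of i] zero tri_ideal_eq_0_iff[of "Suc i" n, where ?'a='a]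
        tri_ideal_eq_0_iff[of "Suc i" m, where ?'a='a] by simp
  qed
  from this[of m] this[of n] have "m = n" by auto
  with assms show False by blast
qed

theorem proposition2p1:
  fixes n :: nat
  assumes "n \<ge> 2"
  shows
    "(lie_solvable dscale commutator (tri n :: 'a::field_char_0 mpoly_map set) \<and>
      \<not> lie_nilpotent dscale commutator (tri n :: 'a mpoly_map set)) \<and>
     ((tri n :: 'a mpoly_map set) = tri_ideal n 1 \<and>
      (\<forall>i\<in>{1..n}. (tri_ideal n (i + 1) :: 'a mpoly_map set) \<subset> tri_ideal n i) \<and>
      (tri_ideal n (n + 1) :: 'a mpoly_map set) = {0} \<and>
      (\<forall>i\<in>{1..n + 1}. lie_ideal dscale commutator (tri n :: 'a mpoly_map set) (tri_ideal n i)) \<and>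
      (\<forall>i. derived_series dscale commutator (tri n :: 'a mpoly_map set) i = tri_ideal n (i + 1))) \<and>
     (upper_central_series dscale commutator (tri n :: 'a mpoly_map set) 0 = tri n \<and>
      (\<forall>i\<ge>1. upper_central_series dscale commutator (tri n :: 'a mpoly_map set) i = tri_ideal n 2)) \<and>
     (\<forall>D\<in>(tri n :: 'a mpoly_map set). locally_nilpotent_on pscale (Pol n) D) \<and>
     (\<forall>D\<in>(tri n :: 'a mpoly_map set).
        lie_derivation dscale commutator (tri n) (commutator D) \<and>
        locally_nilpotent_on dscale (tri n) (commutator D)) \<and>
     lie_centre commutator (tri n :: 'a mpoly_map set) = {dscale c (partial n n) | c. True} \<and>
     (\<forall>m\<ge>2. m \<noteq> n \<longrightarrow>
        \<not> lie_isomorphic dscale commutator (tri m :: 'a mpoly_map set)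
            dscale commutator (tri n :: 'a mpoly_map set))"
proof (intro conjI ballI allI impI)
  have "derived_series dscale commutator (tri n :: 'a mpoly_map set) n = {0}"
    by (simp add: derived_series_tri tri_ideal_beyond)
  then show "lie_solvable dscale commutator (tri n :: 'a mpoly_map set)"
    unfolding lie_solvable_def by blast
next
  have "upper_central_series dscale commutator (tri n :: 'a mpoly_map set) i \<noteq> {0}" for i
  proof (cases i)
    case 0
    then show ?thesis
      using tri_ideal_eq_0_iff[of 1 n, where ?'a='a] assms by (simp add: tri_eq)
  next
    case (Suc k)
    then show ?thesis
      using upper_central_series_tri[of n k, where ?'a='a]
        tri_ideal_eq_0_iff[of 2 n, where ?'a='a] assms
      by (simp del: upper_central_series.simps)
  qed
  then show "\<not> lie_nilpotent dscale commutator (tri n :: 'a mpoly_map set)"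
    unfolding lie_nilpotent_def by blast
next
  fix i :: nat assume "i \<ge> 1"
  then show "upper_central_series dscale commutator (tri n :: 'a mpoly_map set) i = tri_ideal n 2"
    using assms upper_central_series_tri[of n "i - 1"] by simp
next
  fix D :: "'a mpoly_map" assume D: "D \<in> tri n"
  then show "lie_derivation dscale commutator (tri n) (commutator D)"
    by (rule lie_algebra.inner_derivation[OF lie_algebra_tri])
  then show "locally_nilpotent_on dscale (tri n) (commutator D)"
    using tri_ad_nilpotent_at[OF D] by (simp add: locally_nilpotent_on_def lie_derivation_def)
next
  fix i assume "i \<in> {1..n}"
  then show "(tri_ideal n (i + 1) :: 'a mpoly_map set) \<subset> tri_ideal n i"
    by (rule tri_ideal_psubset)
next
  show "(tri n :: 'a mpoly_map set) = tri_ideal n 1" by (rule tri_eq)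
qed (use assms in \<open>simp_all add: derived_series_tri tri_ideal_beyond lie_ideal_tri_ideal
  tri_locally_nilpotent lie_centre_tri tri_not_isomorphic\<close>)

end
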